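(* Let $n\ge 3$, let $z\in\mathbb{S}^{n-1}$ and let $\phi$ be the width with respect to $z$. There exist convex polytopes $K$, $K'$ in $\mathbb{R}^n$ such that $K$ is centrally symmetric, $K'$ is not a translation of $K$, and $g_{K,\phi}=g_{K',\phi}$.
   Context: $\mathbb{S}^{n-1}$ is the Euclidean unit sphere in $\mathbb{R}^n$. For a nonempty compact convex set $K\subset\mathbb{R}^n$ the width with respect to $z$ is $\phi(K)=w(K,z)=\max_{x\in K}\langle x,z\rangle-\min_{x\in K}\langle x,z\rangle$, and $\phi(\emptyset)=0$. The $\phi$-covariogram of a convex body (compact convex set with nonempty interior) $K\subset\mathbb{R}^n$ is $g_{K,\phi}:\mathbb{R}^n\to\mathbb{R}$, $g_{K,\phi}(x)=\phi(K\cap(K+x))$; the polytopes here are convex bodies. A set is centrally symmetric if it coincides with its reflection at some point. *)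

theory Defs
  imports "HOL-Analysis.Analysis"
begin

text \<open>The intended arguments \<open>K\<close> are compact and convex; there \<open>Sup\<close> and \<open>Inf\<close> are attained,
  so they are the maximum and the minimum of \<open>\<langle>x, z\<rangle>\<close> over \<open>K\<close>. On the empty set the width is
  \<open>0\<close> by convention (needed because \<open>K \<inter> (K + x)\<close> can be empty).\<close>

definition width :: "'a::euclidean_space set \<Rightarrow> 'a \<Rightarrow> real" where
  "width K z = (if K = {} then 0 else (SUP x\<in>K. x \<bullet> z) - (INF x\<in>K. x \<bullet> z))"

definition covariogram :: "('a::euclidean_space set \<Rightarrow> real) \<Rightarrow> 'a set \<Rightarrow> 'a \<Rightarrow> real" where
  "covariogram \<phi> K x = \<phi> (K \<inter> (\<lambda>y. y + x) ` K)"

definition convex_body :: "'a::euclidean_space set \<Rightarrow> bool" where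
  "convex_body K \<longleftrightarrow> compact K \<and> convex K \<and> interior K \<noteq> {}"

text \<open>The reflection at the point \<open>c\<close> is \<open>x \<mapsto> 2c - x\<close>.\<close>

definition centrally_symmetric :: "'a::euclidean_space set \<Rightarrow> bool" where
  "centrally_symmetric K \<longleftrightarrow> (\<exists>c. (\<lambda>x. 2 *\<^sub>R c - x) ` K = K)"

definition translation_of :: "'a::euclidean_space set \<Rightarrow> 'a set \<Rightarrow> bool" where
  "translation_of L K \<longleftrightarrow> (\<exists>t. L = (\<lambda>x. x + t) ` K)"

end

theory Submission
  imports Defs
begin

text \<open>For a right prism \<open>K\<close> with base \<open>A\<close> in the hyperplane orthogonal to \<open>z\<close>, the heights of the
  points of \<open>K \<inter> (K + x)\<close> depend only on the difference set \<open>A - A\<close>. Hence any base \<open>S + S\<close> may be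
  replaced by the centrally symmetric base \<open>S - S\<close>, because both have the difference set
  \<open>S + S - S - S\<close>. If \<open>S\<close> is a simplex of dimension at least 2, then the prism over \<open>S + S = 2S\<close> is
  not centrally symmetric, so it is not a translate of the prism over \<open>S - S\<close>.\<close>

definition prism :: "'a::euclidean_space set \<Rightarrow> 'a \<Rightarrow> 'a set" where
  "prism A z = (\<lambda>(a, t). a + t *\<^sub>R z) ` (A \<times> {0..1::real})"

text \<open>Like \<open>prism\<close>, an image of a product under a linear map, so that polytopes
  are preserved by \<open>polytope_Times\<close> and \<open>polytope_linear_image\<close>.\<close>

definition sumset :: "'a::euclidean_space set \<Rightarrow> 'a set \<Rightarrow> 'a set" where
  "sumset A B = (\<lambda>(a, b). a + b) ` (A \<times> B)"

definition diffset :: "'a::euclidean_space set \<Rightarrow> 'a set \<Rightarrow> 'a set" where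
  "diffset A B = (\<lambda>(a, b). a - b) ` (A \<times> B)"

lemma prismI: "a \<in> A \<Longrightarrow> 0 \<le> t \<Longrightarrow> t \<le> 1 \<Longrightarrow> a + t *\<^sub>R z \<in> prism A z"
  by (auto simp: prism_def)

lemma subset_prism: "A \<subseteq> prism A z"
  using prismI[of _ A 0 z] by auto

lemma sumsetI: "a \<in> A \<Longrightarrow> b \<in> B \<Longrightarrow> a + b \<in> sumset A B"
  by (auto simp: sumset_def)

lemma diffsetI: "a \<in> A \<Longrightarrow> b \<in> B \<Longrightarrow> a - b \<in> diffset A B"
  by (auto simp: diffset_def)

lemma polytope_prism:
  assumes "polytope A"
  shows "polytope (prism A z)"
  unfolding prism_def
proof (rule polytope_linear_image)
  show "linear (\<lambda>(a, t). a + t *\<^sub>R z)"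
    by (rule linearI) (auto simp: algebra_simps)
  show "polytope (A \<times> {0..1::real})"
    using assms polytope_interval[of 0 "1::real"] by (simp add: polytope_Times)
qed

lemma polytope_sumset:
  assumes "polytope A" "polytope B"
  shows "polytope (sumset A B)"
  unfolding sumset_def
proof (rule polytope_linear_image)
  show "linear (\<lambda>(a, b). a + b)"
    by (rule linearI) (auto simp: algebra_simps)
qed (use assms in \<open>simp add: polytope_Times\<close>)

lemma polytope_diffset:
  assumes "polytope A" "polytope B"
  shows "polytope (diffset A B)"
  unfolding diffset_def
proof (rule polytope_linear_image)
  show "linear (\<lambda>(a, b). a - b)"
    by (rule linearI) (auto simp: algebra_simps)
qed (use assms in \<open>simp add: polytope_Times\<close>)

lemma diffset_sumset_eq_diffset_diffset:
  "diffset (sumset S S) (sumset S S) = diffset (diffset S S) (diffset S S)"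
proof (intro set_eqI iffI)
  fix x assume "x \<in> diffset (sumset S S) (sumset S S)"
  then obtain a b c d where "a \<in> S" "b \<in> S" "c \<in> S" "d \<in> S" "x = (a + b) - (c + d)"
    by (auto simp: diffset_def sumset_def)
  moreover have "(a + b) - (c + d) = (a - c) - (d - b)"
    by simp
  ultimately show "x \<in> diffset (diffset S S) (diffset S S)"
    by (simp add: diffsetI)
next
  fix x assume "x \<in> diffset (diffset S S) (diffset S S)"
  then obtain a b c d where "a \<in> S" "b \<in> S" "c \<in> S" "d \<in> S" "x = (a - b) - (c - d)"
    by (auto simp: diffset_def)
  moreover have "(a - b) - (c - d) = (a + d) - (b + c)"
    by simp
  ultimately show "x \<in> diffset (sumset S S) (sumset S S)"
    by (simp add: diffsetI sumsetI)
qed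

text \<open>The width sees a set only through its heights over z. The default value 0 respects this,
  because a set is empty exactly when its image is.\<close>

lemma width_cong:
  assumes "(\<lambda>y. y \<bullet> z) ` L = (\<lambda>y. y \<bullet> z) ` M"
  shows "width L z = width M z"
proof -
  have "L = {} \<longleftrightarrow> M = {}"
    using assms by (metis image_is_empty)
  then show ?thesis
    unfolding width_def using assms by simp
qed

text \<open>A point a + t z of the prism is the translate by x of b + s z iff x - (t - s) z = a - b,
  and its height is t because A is orthogonal to the unit vector z. So A enters the right-hand side
  only through \<open>diffset A A\<close>.\<close>

lemma heights_prism_Int_translate:
  assumes "\<And>a. a \<in> A \<Longrightarrow> a \<bullet> z = 0" "norm z = 1"
  shows "(\<lambda>y. y \<bullet> z) ` (prism A z \<inter> (\<lambda>y. y + x) ` prism A z)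
    = {t \<in> {0..1}. \<exists>s\<in>{0..1}. x - (t - s) *\<^sub>R z \<in> diffset A A}" (is "?L = ?R")
proof
  have zz: "z \<bullet> z = 1"
    using assms(2) by (simp add: dot_square_norm)
  show "?L \<subseteq> ?R"
  proof
    fix h assume "h \<in> ?L"
    then obtain y where y: "y \<in> prism A z" "y \<in> (\<lambda>y. y + x) ` prism A z" "h = y \<bullet> z"
      by blast
    obtain a t where a: "a \<in> A" "t \<in> {0..1}" "y = a + t *\<^sub>R z"
      using y(1) by (auto simp: prism_def)
    obtain b s where b: "b \<in> A" "s \<in> {0..1}" "y = b + s *\<^sub>R z + x"
      using y(2) by (auto simp: prism_def)
    have "h = t"
      using y(3) a assms(1) zz by (simp add: inner_add_left)
    moreover have "x - (t - s) *\<^sub>R z = a - b"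
      using a(3) b(3) by (simp add: algebra_simps)
    then have "x - (t - s) *\<^sub>R z \<in> diffset A A"
      using a(1) b(1) by (auto simp: diffset_def)
    ultimately show "h \<in> ?R"
      using a(2) b(2) by blast
  qed
  show "?R \<subseteq> ?L"
  proof
    fix t assume "t \<in> ?R"
    then obtain s a b where t: "t \<in> {0..1}" and s: "s \<in> {0..1}"
      and ab: "a \<in> A" "b \<in> A" "x - (t - s) *\<^sub>R z = a - b"
      by (auto simp: diffset_def)
    let ?y = "a + t *\<^sub>R z"
    have "?y \<in> prism A z" "b + s *\<^sub>R z \<in> prism A z"
      using t s ab by (auto intro: prismI)
    moreover have "?y = (b + s *\<^sub>R z) + x"
      using ab(3) by (simp add: algebra_simps)
    moreover have "?y \<bullet> z = t"
      using ab assms(1) zz by (simp add: inner_add_left)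
    ultimately show "t \<in> ?L"
      by (metis (no_types, lifting) IntI image_eqI)
  qed
qed

lemma covariogram_width_prism_cong:
  assumes "\<And>a. a \<in> A \<Longrightarrow> a \<bullet> z = 0" "\<And>b. b \<in> B \<Longrightarrow> b \<bullet> z = 0" "norm z = 1"
    and "diffset A A = diffset B B"
  shows "covariogram (\<lambda>L. width L z) (prism A z) = covariogram (\<lambda>L. width L z) (prism B z)"
  unfolding covariogram_def
  by (intro ext width_cong)
    (simp only: heights_prism_Int_translate[OF assms(1,3)]
      heights_prism_Int_translate[OF assms(2,3)] assms(4))

text \<open>One inclusion suffices because a point reflection is its own inverse.\<close>

lemma centrally_symmetricI:
  assumes "\<And>x. x \<in> K \<Longrightarrow> 2 *\<^sub>R c - x \<in> K"
  shows "centrally_symmetric K"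
  unfolding centrally_symmetric_def
proof (intro exI[of _ c] equalityI subsetI)
  fix x assume "x \<in> K"
  then have "2 *\<^sub>R c - (2 *\<^sub>R c - x) \<in> (\<lambda>x. 2 *\<^sub>R c - x) ` K"
    using assms by blast
  then show "x \<in> (\<lambda>x. 2 *\<^sub>R c - x) ` K"
    by simp
qed (use assms in auto)

text \<open>The centre moves along with the set. Thus a body without a centre of symmetry cannot be
  a translate of one that has it.\<close>

lemma centrally_symmetric_translation:
  assumes "centrally_symmetric K" "translation_of L K"
  shows "centrally_symmetric L"
proof -
  obtain c t where c: "(\<lambda>x. 2 *\<^sub>R c - x) ` K = K" and t: "L = (\<lambda>x. x + t) ` K"
    using assms by (auto simp: centrally_symmetric_def translation_of_def)
  show ?thesis
  proof (rule centrally_symmetricI[of _ "c + t"])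
    fix y assume "y \<in> L"
    then obtain x where x: "x \<in> K" "y = x + t"
      using t by auto
    have "2 *\<^sub>R c - x \<in> K"
      using c x by blast
    moreover have "2 *\<^sub>R (c + t) - y = (2 *\<^sub>R c - x) + t"
      using x by (simp add: algebra_simps scaleR_2)
    ultimately show "2 *\<^sub>R (c + t) - y \<in> L"
      using t by auto
  qed
qed

lemma centrally_symmetric_prism_diffset: "centrally_symmetric (prism (diffset S S) z)"
\<comment> \<open>The base is symmetric about 0 and the heights [0, 1] about 1/2, so the centre is
  z/2.\<close>
proof (rule centrally_symmetricI[of _ "(1/2) *\<^sub>R z"])
  fix x assume "x \<in> prism (diffset S S) z"
  then obtain a b t where x: "a \<in> S" "b \<in> S" "0 \<le> t" "t \<le> 1" "x = (a - b) + t *\<^sub>R z"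
    by (auto simp: prism_def diffset_def)
  then have "(b - a) + (1 - t) *\<^sub>R z \<in> prism (diffset S S) z"
    by (intro prismI diffsetI) auto
  moreover have "2 *\<^sub>R (1/2) *\<^sub>R z - x = (b - a) + (1 - t) *\<^sub>R z"
    using x by (simp add: algebra_simps)
  ultimately show "2 *\<^sub>R (1/2) *\<^sub>R z - x \<in> prism (diffset S S) z"
    by simp
qed

text \<open>The prism contains the full-dimensional simplex with vertices 0 and B: all vertices but
  z lie in the base A, and z lies above 0 in the top face.\<close>

lemma interior_prism_nonempty:
  fixes A :: "'a::euclidean_space set"
  assumes "polytope A" "convex hull (insert 0 (B - {z})) \<subseteq> A"
    and "z \<in> B" "independent B" "card B = DIM('a)"
  shows "interior (prism A z) \<noteq> {}"
proof -
  have sub: "insert 0 (B - {z}) \<subseteq> A"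
    using assms(2) hull_subset[of "insert 0 (B - {z})" convex] by blast
  have "z \<in> prism A z"
    using prismI[of 0 A 1 z] sub by simp
  then have "insert 0 B \<subseteq> prism A z"
    using sub subset_prism[of A z] by blast
  then have "convex hull (insert 0 B) \<subseteq> prism A z"
    using polytope_imp_convex[OF polytope_prism[OF assms(1)]] by (rule hull_minimal)
  moreover obtain p where "p \<in> interior (convex hull (insert 0 B))"
    using interior_simplex_nonempty assms(4,5) independent_imp_finite by blast
  ultimately show ?thesis
    using interior_mono by blast
qed

lemma convex_hull_inner_ge:
  assumes "x \<in> convex hull T" "\<And>y. y \<in> T \<Longrightarrow> m \<le> y \<bullet> u"
  shows "m \<le> x \<bullet> u"
proof -
  have "convex hull T \<subseteq> {y. u \<bullet> y \<ge> m}"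
    using assms(2) by (intro hull_minimal convex_halfspace_ge) (auto simp: inner_commute)
  then show ?thesis
    using assms(1) by (auto simp: inner_commute)
qed

text \<open>The bounds on A extend to the prism because u and v are orthogonal to z. For a centre c,
  reflecting u and v gives 2c . u >= m and 2c . v >= m, while reflecting 0 gives 2c . u + 2c . v <=
  m, which is impossible for m > 0.\<close>

lemma not_centrally_symmetric_prism_corner:
  assumes "0 \<in> A" "u \<in> A" "v \<in> A" "u \<bullet> u = m" "v \<bullet> v = m" "0 < m"
    and orth: "z \<bullet> u = 0" "z \<bullet> v = 0"
    and A: "\<And>a. a \<in> A \<Longrightarrow> 0 \<le> a \<bullet> u \<and> 0 \<le> a \<bullet> v \<and> a \<bullet> u + a \<bullet> v \<le> m"
  shows "\<not> centrally_symmetric (prism A z)"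
proof
  assume "centrally_symmetric (prism A z)"
  then obtain c where c: "(\<lambda>x. 2 *\<^sub>R c - x) ` prism A z = prism A z"
    by (auto simp: centrally_symmetric_def)
  have P: "0 \<le> x \<bullet> u \<and> 0 \<le> x \<bullet> v \<and> x \<bullet> u + x \<bullet> v \<le> m" if "x \<in> prism A z" for x
    using that A orth by (auto simp: prism_def inner_add_left)
  have reflected: "2 *\<^sub>R c - a \<in> prism A z" if "a \<in> A" for a
    using that c subset_prism by blast
  show False
    using P[OF reflected[OF assms(1)]] P[OF reflected[OF assms(2)]] P[OF reflected[OF assms(3)]]
      assms(4-6) by (simp add: inner_diff_left)
qed

theorem theorem1p4:
  fixes z :: "real ^ 'n"
  assumes "CARD('n) \<ge> 3"
    and "z \<in> sphere 0 1"
  shows "\<exists>K K' :: (real ^ 'n) set.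
           polytope K \<and> convex_body K \<and> polytope K' \<and> convex_body K' \<and>
           centrally_symmetric K \<and> \<not> translation_of K' K \<and>
           covariogram (\<lambda>L. width L z) K = covariogram (\<lambda>L. width L z) K'"
proof -
  have nz: "norm z = 1"
    using assms(2) by simp
  obtain B where zB: "z \<in> B" and orth: "pairwise orthogonal B"
    and norm1: "\<And>x. x \<in> B \<Longrightarrow> norm x = 1"
    and indep: "independent B" and card: "card B = DIM(real ^ 'n)"
    using vector_in_orthonormal_basis[OF nz] by metis
  have finB: "finite B"
    using indep independent_imp_finite by blast
  \<comment> \<open>Here n >= 3 enters: two basis vectors besides z are needed. For n = 2 the base
    would be a segment, which is itself centrally symmetric.\<close>
  have "\<not> card (B - {z}) \<le> Suc 0"
    using zB card assms(1) finB by simp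
  then have "\<not> (\<forall>u\<in>B - {z}. \<forall>v\<in>B - {z}. u = v)"
    using finB by (simp only: card_le_Suc0_iff_eq finite_Diff not_False_eq_True)
  then obtain u v where u: "u \<in> B" "u \<noteq> z" and v: "v \<in> B" "v \<noteq> z" and uv: "u \<noteq> v"
    by blast
  have inner_B: "x \<bullet> y = (if x = y then 1 else 0)" if "x \<in> B" "y \<in> B" for x y
    using that orth norm1[of x] by (auto simp: pairwise_def orthogonal_def dot_square_norm)
  \<comment> \<open>A simplex of dimension n - 1 in the hyperplane orthogonal to z, with a
    right-angled corner at 0.\<close>
  define S where "S = convex hull (insert 0 (B - {z}))"
  have poly: "polytope S"
    unfolding S_def using finB by (intro polytope_convex_hull) simp
  have S: "0 \<in> S" "u \<in> S" "v \<in> S"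
    unfolding S_def using u v by (auto intro: hull_inc)
  have Sz: "a \<bullet> z = 0" if "a \<in> S" for a
  proof -
    \<comment> \<open>The half-space bound for both z and -z yields the equality.\<close>
    have "0 \<le> a \<bullet> z"
      using that unfolding S_def
      by (rule convex_hull_inner_ge) (use inner_B zB in auto)
    moreover have "0 \<le> a \<bullet> (- z)"
      using that unfolding S_def
      by (rule convex_hull_inner_ge) (use inner_B zB in auto)
    ultimately show ?thesis
      by simp
  qed
  have S_bounds: "0 \<le> a \<bullet> u \<and> 0 \<le> a \<bullet> v \<and> a \<bullet> u + a \<bullet> v \<le> 1" if "a \<in> S" for a
  proof -
    have "0 \<le> a \<bullet> u"
      using that unfolding S_def
      by (rule convex_hull_inner_ge) (use inner_B u in auto)
    moreover have "0 \<le> a \<bullet> v"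
      using that unfolding S_def
      by (rule convex_hull_inner_ge) (use inner_B v in auto)
    \<comment> \<open>The upper bound is a lower bound for the negated functional. It holds at the
      vertices since, by u \<noteq> v, none of them has both coordinates equal to 1.\<close>
    moreover have "-1 \<le> a \<bullet> (- (u + v))"
      using that unfolding S_def
      by (rule convex_hull_inner_ge) (use inner_B u v uv in \<open>auto simp: inner_diff_right\<close>)
    ultimately show ?thesis
      by (simp add: inner_diff_right)
  qed
  \<comment> \<open>As 0 is in S, both bases contain S, which gives both prisms nonempty
    interior.\<close>
  have S_sub: "S \<subseteq> sumset S S" "S \<subseteq> diffset S S"
    using sumsetI[of _ S 0 S] diffsetI[of _ S 0 S] S(1) by auto
  let ?K = "prism (diffset S S) z" and ?K' = "prism (sumset S S) z"
  have body: "polytope (prism A z) \<and> convex_body (prism A z)" if "polytope A" "S \<subseteq> A" for A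
    using polytope_prism[OF that(1), of z] interior_prism_nonempty[OF that(1) _ zB indep card] that(2)
    by (simp add: S_def convex_body_def polytope_imp_compact polytope_imp_convex)
  have "\<not> centrally_symmetric ?K'"
  \<comment> \<open>The base is 2S, whose corner at 0 has the neighbours 2u and 2v of squared length
    4. For a = b + c with b, c in S, the sum of the two products is at most 2(1 + 1) = 4.\<close>
  proof (rule not_centrally_symmetric_prism_corner[where u = "2 *\<^sub>R u" and v = "2 *\<^sub>R v" and m = 4])
    show "0 \<in> sumset S S"
      using S(1) S_sub by blast
    show "2 *\<^sub>R u \<in> sumset S S" "2 *\<^sub>R v \<in> sumset S S"
      unfolding scaleR_2 by (intro sumsetI S)+
    show "0 \<le> a \<bullet> 2 *\<^sub>R u \<and> 0 \<le> a \<bullet> 2 *\<^sub>R v \<and> a \<bullet> 2 *\<^sub>R u + a \<bullet> 2 *\<^sub>R v \<le> 4"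
      if a: "a \<in> sumset S S" for a
    proof -
      obtain b c where "b \<in> S" "c \<in> S" "a = b + c"
        using a by (auto simp: sumset_def)
      then show ?thesis
        using S_bounds[of b] S_bounds[of c] by (simp add: inner_add_left)
    qed
  qed (use inner_B u v zB in auto)
  then have "\<not> translation_of ?K' ?K"
    using centrally_symmetric_translation centrally_symmetric_prism_diffset by blast
  moreover have "covariogram (\<lambda>L. width L z) ?K = covariogram (\<lambda>L. width L z) ?K'"
  proof (rule covariogram_width_prism_cong[OF _ _ nz])
    show "a \<bullet> z = 0" if "a \<in> diffset S S" for a
      using that Sz by (auto simp: diffset_def inner_diff_left)
    show "a \<bullet> z = 0" if "a \<in> sumset S S" for a
      using that Sz by (auto simp: sumset_def inner_add_left)
  qed (simp add: diffset_sumset_eq_diffset_diffset)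
  ultimately show ?thesis
    using body[OF polytope_diffset[OF poly poly] S_sub(2)]
      body[OF polytope_sumset[OF poly poly] S_sub(1)] centrally_symmetric_prism_diffset by blast
qed

end
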